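(* Let $p\geq 3$ be a prime. Suppose there exists a covering system of the integers whose moduli are all odd, square-free, greater than $1$, and pairwise distinct, except that $p$ is used exactly twice as a modulus. Then there exists an odd covering system of the integers, i.e. a covering system of the integers whose moduli are all odd, pairwise distinct, and greater than $1$.
   Context: A covering system of the integers is a finite collection of congruences $x\equiv r_j \pmod{m_j}$ such that every integer satisfies at least one of them. "$p$ is used exactly twice as a modulus" means exactly two congruences of the system have modulus $p$. *)

theory Defs
  imports "HOL-Number_Theory.Number_Theory" "HOL-Computational_Algebra.Squarefree"
begin

(* A pair (r, m) stands for the congruence x = r (mod m).  Pairs (r, m) and (r', m) with r and r'
   congruent modulo m count as two congruences, so a system may also repeat a residue class. *)
type_synonym congruence = "int \<times> nat"

definition covering_system :: "congruence set \<Rightarrow> bool" where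
  "covering_system C \<longleftrightarrow>
     finite C \<and> (\<forall>(r, m) \<in> C. m > 0) \<and> (\<forall>x :: int. \<exists>(r, m) \<in> C. [x = r] (mod int m))"

definition odd_covering_system :: "congruence set \<Rightarrow> bool" where
  "odd_covering_system C \<longleftrightarrow>
     covering_system C \<and> (\<forall>(r, m) \<in> C. odd m \<and> m > 1) \<and> inj_on snd C"

end

theory Submission
  imports Defs
begin

text \<open>
  Let \<open>r\<^sub>1, r\<^sub>2\<close> be the residues used with modulus \<open>p\<close>, and drop the congruence modulo \<open>p\<close> with
  residue \<open>r\<^sub>2\<close>; the class of \<open>r\<^sub>2\<close> has to be covered again. If \<open>x = r\<^sub>2 + p\<^sup>k u\<close> with \<open>p\<close> not
  dividing \<open>u\<close>, then the original system covers the class of \<open>r\<^sub>2 + u\<close> modulo \<open>p\<close>, and the moduli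
  \<open>p d\<close> used there can be reused as \<open>p\<^sup>k\<^sup>+\<^sup>1 d\<close> to cover \<open>x\<close>; they are new for \<open>k \<ge> 1\<close> since the
  original moduli are squarefree. Doing so for all \<open>k < q\<close>, where \<open>q\<close> is a prime exceeding all
  moduli, leaves only the class of \<open>r\<^sub>2\<close> modulo \<open>p\<^sup>q\<close>. The \<open>q\<close> residue classes modulo \<open>q\<close> inside it
  are covered by congruences with the \<open>q\<close> moduli \<open>q p\<^sup>i\<close>, \<open>i < q\<close>.
\<close>

lemma covering_systemD:
  assumes "covering_system C"
  obtains r m where "(r, m) \<in> C" "[x = r] (mod int m)"
proof -
  have "\<exists>(r, m) \<in> C. [x = r] (mod int m)"
    using assms by (simp add: covering_system_def)
  then show thesis using that by blast
qed

lemma inj_on_Un_disjoint_images: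
  assumes "inj_on f A" "inj_on f B" "f ` A \<inter> f ` B = {}"
  shows "inj_on f (A \<union> B)"
  unfolding inj_on_Un
proof (intro conjI)
  show "f ` (A - B) \<inter> f ` (B - A) = {}" using assms(3) by blast
qed fact+

lemma squarefree_not_dvd_div_prime:
  fixes p m :: nat
  assumes "squarefree m" "prime p" "p dvd m"
  shows "\<not> p dvd m div p"
proof
  assume "p dvd m div p"
  then have "p ^ 2 dvd m"
    using assms(2,3) by (simp add: dvd_div_iff_mult power2_eq_square prime_gt_0_nat)
  with assms(1) have "is_unit p" by (rule squarefreeD)
  with assms(2) show False by simp
qed

text \<open>A residue class modulo \<open>p\<close> looks the same to all moduli prime to \<open>p\<close>, so the congruences
  covering the class of \<open>a\<close> cover every class once \<open>p\<close> is removed from their moduli.\<close>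

lemma covering_shift_residue:
  fixes p :: nat and a x :: int
  assumes cov: "covering_system C" and sf: "\<And>r m. (r, m) \<in> C \<Longrightarrow> squarefree m" and p: "prime p"
    and x: "\<And>r m. (r, m) \<in> C \<Longrightarrow> \<not> p dvd m \<Longrightarrow> \<not> [x = r] (mod int m)"
  obtains r m where "(r, m) \<in> C" "p dvd m" "[a = r] (mod int p)" "[x = r] (mod int (m div p))"
proof -
  have fin: "finite C" using cov by (simp add: covering_system_def)
  define f where "f m = (if p dvd m then m div p else m)" for m
  define M where "M = (\<Prod>c\<in>C. f (snd c))"
  have "coprime (f m) p" if "(r, m) \<in> C" for r m
    using squarefree_not_dvd_div_prime[OF sf[OF that] p] p
    by (simp add: f_def coprime_commute[of _ p] prime_imp_coprime)
  then have "coprime M p"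
    unfolding M_def by (intro prod_coprime_left) auto
  then have "coprime (int M) (int p)" by simp
  \<comment> \<open>\<open>y\<close> imitates \<open>x\<close> modulo the \<open>p\<close>-free part
    of every modulus but lies in the class of \<open>a\<close> modulo \<open>p\<close>; whatever
    congruence covers \<open>y\<close> is the one wanted.\<close>
  then obtain y where y: "[y = x] (mod int M)" "[y = a] (mod int p)"
    using binary_chinese_remainder_int by blast
  obtain r m where rm: "(r, m) \<in> C" "[y = r] (mod int m)"
    using covering_systemD[OF cov] .
  have "f m dvd M"
    unfolding M_def using rm(1) fin by (metis dvd_prodI snd_conv)
  then have yx: "[x = y] (mod int (f m))"
    using y(1) by (meson cong_dvd_modulus cong_sym int_dvd_int_iff)
  have "f m dvd m" by (cases "p dvd m") (auto simp: f_def elim!: dvdE)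
  then have "[y = r] (mod int (f m))"
    using rm(2) by (meson cong_dvd_modulus int_dvd_int_iff)
  with yx have xr: "[x = r] (mod int (f m))" by (rule cong_trans)
  have pm: "p dvd m"
  proof (rule ccontr)
    assume "\<not> p dvd m"
    \<comment> \<open>Here \<open>f m = m\<close>, so \<open>x\<close> itself would lie on a
      congruence with modulus prime to \<open>p\<close>.\<close>
    with x[OF rm(1)] xr show False by (simp add: f_def)
  qed
  then have "[y = r] (mod int p)"
    using rm(2) by (meson cong_dvd_modulus int_dvd_int_iff)
  then have "[a = r] (mod int p)" using y(2) by (meson cong_sym cong_trans)
  then show thesis using that rm(1) pm xr by (simp add: f_def)
qed

theorem theorem3p2:
  fixes p :: nat
  assumes "prime p" and "p \<ge> 3"
    and "\<exists>C. covering_system C \<and>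
           (\<forall>(r, m) \<in> C. odd m \<and> squarefree m \<and> m > 1) \<and>
           inj_on snd {(r, m) \<in> C. m \<noteq> p} \<and>
           card {(r, m) \<in> C. m = p} = 2"
  shows "\<exists>C. odd_covering_system C"
proof -
  note p = \<open>prime p\<close>
  obtain C where cov: "covering_system C"
    and C: "\<And>r m. (r, m) \<in> C \<Longrightarrow> odd m \<and> squarefree m \<and> m > 1"
    and inj: "inj_on snd {(r, m) \<in> C. m \<noteq> p}"
    and two: "card {(r, m) \<in> C. m = p} = 2"
    using assms(3) by blast
  have fin: "finite C" using cov by (simp add: covering_system_def)
  obtain c1 c2 where c12: "{(r, m) \<in> C. m = p} = {c1, c2}"
    using two by (auto simp: card_2_iff)
  define r1 r2 where "r1 = fst c1" and "r2 = fst c2"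
  have "c1 \<in> {(r, m) \<in> C. m = p}" "c2 \<in> {(r, m) \<in> C. m = p}" using c12 by auto
  then have r1: "(r1, p) \<in> C" and r2: "(r2, p) \<in> C" and c: "c1 = (r1, p)" "c2 = (r2, p)"
    by (auto simp: r1_def r2_def)
  have only: "r = r1 \<or> r = r2" if "(r, p) \<in> C" for r
    using that c12 c by blast
  have oddp: "odd p" using C r1 by blast

  \<comment> \<open>\<open>N\<close> is kept unchanged. \<open>D\<close> holds the congruences to be
    lifted to higher powers of \<open>p\<close>; leaving out \<open>(r2, p)\<close> makes its moduli
    distinct.\<close>
  define N where "N = {(r, m) \<in> C. \<not> p dvd m}"
  define D where "D = insert (r1, p) {(r, m) \<in> C. p dvd m \<and> m \<noteq> p}"
  have D: "(r, m) \<in> C" "p dvd m" if "(r, m) \<in> D" for r m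
    using that r1 by (auto simp: D_def)
  have finN: "finite N" and finD: "finite D"
    using finite_subset[OF _ fin] D by (auto simp: N_def subset_iff)
  have injN: "inj_on snd N"
    by (rule inj_on_subset[OF inj]) (auto simp: N_def)
  have injD: "r = r'" if "(r, m) \<in> D" "(r', m) \<in> D" for r r' m
    using that inj_onD[OF inj, of "(r, m)" "(r', m)"] by (auto simp: D_def)

  obtain q where q: "prime q" and qgt: "q > p + Max (snd ` C)"
    using bigger_prime by blast
  have qC: "\<not> q dvd m" if "(r, m) \<in> C" for r m
  proof -
    have "m \<le> Max (snd ` C)"
      using that fin by (intro Max_ge) (auto simp: image_iff intro: bexI[of _ "(r, m)"])
    then show ?thesis using qgt C[OF that] by (auto dest: dvd_imp_le)
  qed
  have qp: "\<not> q dvd p" using qC r1 by blast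
  have qpk: "\<not> q dvd p ^ k" for k using qp q prime_dvd_power by blast
  have oddq: "odd q" using q qgt assms(2) prime_odd_nat by simp
  have copk: "coprime (int q) (int (p ^ k))" for k
    using prime_imp_coprime[OF q qpk] by simp

  \<comment> \<open>For \<open>u\<close> congruent to \<open>r - r2\<close> modulo \<open>p\<close>,
    the number \<open>r2 + u * p ^ k\<close> is determined modulo \<open>p ^ Suc k\<close>; the
    \<open>p\<close>-free part of the modulus keeps the residue \<open>r\<close>.\<close>
  have "\<exists>s. [s = r] (mod int (m div p)) \<and>
      [s = r2 + (r - r2) * int p ^ k] (mod int (p ^ Suc k))" if "(r, m) \<in> D" for r m k
  proof -
    have "\<not> p dvd m div p"
      using squarefree_not_dvd_div_prime p C D[OF that] by blast
    then have "coprime (int (m div p)) (int (p ^ Suc k))"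
      using p by (metis coprime_commute coprime_int_iff coprime_power_right_iff prime_imp_coprime)
    then show ?thesis by (rule binary_chinese_remainder_int)
  qed
  then obtain s where s: "\<And>r m k. (r, m) \<in> D \<Longrightarrow> [s r m k = r] (mod int (m div p))"
      "\<And>r m k. (r, m) \<in> D \<Longrightarrow> [s r m k = r2 + (r - r2) * int p ^ k] (mod int (p ^ Suc k))"
    by metis
  \<comment> \<open>The class of \<open>t i\<close> contains those \<open>x\<close> in the class of
    \<open>r2\<close> modulo \<open>p ^ q\<close> that are \<open>i\<close> modulo \<open>q\<close>,
    for each \<open>i < q\<close>.\<close>
  have "\<exists>t. [t = int i] (mod int q) \<and> [t = r2] (mod int (p ^ i))" for i
    using binary_chinese_remainder_int[OF copk] .
  then obtain t where t: "\<And>i. [t i = int i] (mod int q)" "\<And>i. [t i = r2] (mod int (p ^ i))"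
    by metis

  \<comment> \<open>For \<open>k = 0\<close> the residue \<open>s r m 0\<close> is congruent to
    \<open>r\<close> modulo \<open>m\<close>, so \<open>E\<close> already contains \<open>D\<close>
    up to the choice of representatives.\<close>
  define E where "E = (\<lambda>((r, m), k). (s r m k, p ^ k * m)) ` (D \<times> {..<q})"
  define T where "T = (\<lambda>i. (t i, q * p ^ i)) ` {..<q}"
  have E: "\<exists>r n k. (r, n) \<in> D \<and> k < q \<and> z = s r n k \<and> m = p ^ k * n" if "(z, m) \<in> E" for z m
    using that by (auto simp: E_def)

  have injE: "inj_on snd E"
  proof -
    \<comment> \<open>Since \<open>m\<close> is squarefree and divisible by \<open>p\<close>, the
      exponent of \<open>p\<close> in \<open>p ^ k * m\<close> is \<open>Suc k\<close>. So the new
      modulus determines \<open>k\<close>, and then \<open>m\<close>.\<close>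
    have "k = k' \<and> m = m'"
      if "(r, m) \<in> D" "(r', m') \<in> D" "p ^ k * m = p ^ k' * m'" for r m k r' m' k'
    proof -
      have mult: "multiplicity p (p ^ k * m) = Suc k" if "(r, m) \<in> D" for r m k
      proof -
        have m: "m = p * (m div p)" using D[OF that] by simp
        have nd: "\<not> p dvd m div p" using squarefree_not_dvd_div_prime p C D[OF that] by blast
        have "p ^ k * m = p ^ Suc k * (m div p)" by (subst m) simp
        then show ?thesis using nd prime_gt_0_nat[OF p] by (intro multiplicity_decomposeI) auto
      qed
      have "k = k'" using mult[OF that(1)] mult[OF that(2)] that(3) by (metis Suc_inject)
      then show ?thesis using that(3) p by (simp add: prime_gt_0_nat)
    qed
    note km = this
    show ?thesis
    proof (rule inj_onI)
      fix c c' assume cE: "c \<in> E" and cE': "c' \<in> E" and eq: "snd c = snd c'"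
      obtain r m k where rm: "(r, m) \<in> D" and c: "c = (s r m k, p ^ k * m)"
        using E[of "fst c" "snd c"] cE by (metis prod.collapse)
      obtain r' m' k' where rm': "(r', m') \<in> D" and c': "c' = (s r' m' k', p ^ k' * m')"
        using E[of "fst c'" "snd c'"] cE' by (metis prod.collapse)
      from eq rm rm' c c' have "k = k' \<and> m = m'" by (intro km) simp_all
      with rm rm' c c' injD show "c = c'" by blast
    qed
  qed
  have injT: "inj_on snd T"
    using prime_gt_1_nat[OF p] prime_gt_0_nat[OF q] by (auto simp: T_def inj_on_def)
  \<comment> \<open>Divisibility by \<open>p\<close> separates \<open>E\<close> from
    \<open>N\<close>, and divisibility by \<open>q\<close> separates \<open>T\<close> from
    both.\<close>
  have pE: "p dvd m" and qE: "\<not> q dvd m" if zm: "(z, m) \<in> E" for z m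
  proof -
    obtain r n k where n: "(r, n) \<in> D" "m = p ^ k * n" using E[OF zm] by blast
    show "p dvd m" using n D(2) by simp
    show "\<not> q dvd m" using n(2) qC[OF D(1)[OF n(1)]] qpk[of k] prime_dvd_mult_iff[OF q] by simp
  qed
  have "snd ` N \<inter> snd ` E = {}"
    using pE unfolding N_def by fastforce
  moreover have "snd ` (N \<union> E) \<inter> snd ` T = {}"
  proof -
    have "\<not> q dvd m" if "m \<in> snd ` (N \<union> E)" for m
      using that qE qC by (auto simp: N_def)
    moreover have "q dvd m" if "m \<in> snd ` T" for m
      using that by (auto simp: T_def)
    ultimately show ?thesis by blast
  qed
  ultimately have injA: "inj_on snd (N \<union> E \<union> T)"
    by (intro inj_on_Un_disjoint_images injN injE injT)

  have oddA: "odd m \<and> m > 1" if "(z, m) \<in> N \<union> E \<union> T" for z m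
    using that
  proof (elim UnE)
    assume "(z, m) \<in> N" then show ?thesis using C by (auto simp: N_def)
  next
    assume "(z, m) \<in> E"
    then obtain r n k where n: "(r, n) \<in> D" "m = p ^ k * n" using E by blast
    then have "odd n" "n > 1" using C D by blast+
    moreover have "p ^ k \<ge> 1" using prime_gt_0_nat[OF p] by simp
    ultimately show ?thesis
      using n oddp by (metis even_mult_iff even_power less_le_trans mult_le_mono1 nat_mult_1)
  next
    assume "(z, m) \<in> T"
    then obtain i where i: "m = q * p ^ i" by (auto simp: T_def)
    have "p ^ i \<ge> 1" using prime_gt_0_nat[OF p] by simp
    then have "m \<ge> q" using i by simp
    with prime_gt_1_nat[OF q] have "m > 1" by (rule less_le_trans)
    then show ?thesis using i oddp oddq by simp
  qed

  have covA: "\<exists>(z, m) \<in> N \<union> E \<union> T. [x = z] (mod int m)" for x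
  proof (cases "\<exists>(z, m) \<in> N. [x = z] (mod int m)")
    case True then show ?thesis by blast
  next
    case False
    then have xN: "\<not> [x = r] (mod int m)" if "(r, m) \<in> C" "\<not> p dvd m" for r m
      using that by (auto simp: N_def)
    show ?thesis
    proof (cases "int p ^ q dvd x - r2")
      case True
      define i where "i = nat (x mod int q)"
      have q0: "int q > 0" using prime_gt_0_nat[OF q] by simp
      have iq: "i < q" using q0 by (simp add: i_def nat_less_iff)
      have "int p ^ i dvd x - r2" using True iq by (meson dvd_trans le_imp_power_dvd less_imp_le)
      then have "[x = r2] (mod int (p ^ i))" by (simp add: cong_iff_dvd_diff)
      then have 1: "[x = t i] (mod int (p ^ i))" using t(2) by (meson cong_sym cong_trans)
      have "[x = int i] (mod int q)" using q0 by (simp add: i_def cong_def)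
      then have 2: "[x = t i] (mod int q)" using t(1) by (meson cong_sym cong_trans)
      have "[x = t i] (mod int (q * p ^ i))"
        using coprime_cong_mult[OF 2 1 copk] by simp
      moreover have "(t i, q * p ^ i) \<in> T" using iq by (auto simp: T_def)
      ultimately show ?thesis by blast
    next
      case False
      then have "x - r2 \<noteq> 0" by auto
      moreover have "\<not> is_unit (int p)" using prime_gt_1_nat[OF p] by simp
      ultimately obtain u where u: "x - r2 = int p ^ multiplicity (int p) (x - r2) * u"
          "\<not> int p dvd u"
        using multiplicity_decompose'[of "x - r2" "int p"] by metis
      define k where "k = multiplicity (int p) (x - r2)"
      have uk: "x = r2 + int p ^ k * u" using u(1) by (simp add: k_def)
      \<comment> \<open>Otherwise \<open>p ^ q\<close> would divide \<open>x - r2\<close>, the case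
        already settled by \<open>T\<close>.\<close>
      have kq: "k < q"
        using False uk by (metis add_diff_cancel_left' dvd_mult2 le_imp_power_dvd not_le)
      \<comment> \<open>The class modulo \<open>p\<close> is read off at \<open>r2 + u\<close>,
        while the \<open>p\<close>-free part of the modulus is matched against \<open>x\<close>
        itself.\<close>
      obtain r m where rm: "(r, m) \<in> C" "p dvd m" "[r2 + u = r] (mod int p)"
          "[x = r] (mod int (m div p))"
        using covering_shift_residue[OF cov _ p xN] C by metis
      have ur: "int p dvd u - (r - r2)"
        using rm(3) by (simp add: cong_iff_dvd_diff algebra_simps)
      \<comment> \<open>If \<open>r = r2\<close>, then \<open>p\<close> would divide
        \<open>u\<close>; hence the dropped congruence \<open>(r2, p)\<close> is never the one
        found.\<close>
      have "r \<noteq> r2" using ur u(2) by auto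
      then have inD: "(r, m) \<in> D" using rm only by (auto simp: D_def)
      have "int (p ^ Suc k) dvd int p ^ k * (u - (r - r2))"
        using mult_dvd_mono[OF dvd_refl ur, of "int p ^ k"] by (simp add: mult.commute)
      then have "[x = r2 + (r - r2) * int p ^ k] (mod int (p ^ Suc k))"
        unfolding cong_iff_dvd_diff uk by (simp add: algebra_simps)
      then have 1: "[x = s r m k] (mod int (p ^ Suc k))"
        using s(2)[OF inD] by (meson cong_sym cong_trans)
      have 2: "[x = s r m k] (mod int (m div p))"
        using s(1)[OF inD] rm(4) by (meson cong_sym cong_trans)
      have "\<not> p dvd m div p" using squarefree_not_dvd_div_prime p C rm by blast
      then have "coprime (int (p ^ Suc k)) (int (m div p))"
        using p by (metis coprime_int_iff coprime_power_left_iff prime_imp_coprime)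
      from coprime_cong_mult[OF 1 2 this]
      have "[x = s r m k] (mod int (p ^ Suc k * (m div p)))" by (simp only: of_nat_mult)
      moreover have "p ^ Suc k * (m div p) = p ^ k * m"
        using rm(2) by (simp add: mult.assoc mult.left_commute)
      moreover have "(s r m k, p ^ k * m) \<in> E"
        unfolding E_def using inD kq by force
      ultimately show ?thesis by (metis (mono_tags, lifting) UnI1 UnI2 case_prodI)
    qed
  qed

  have "finite (N \<union> E \<union> T)" using finN finD by (simp add: E_def T_def)
  then have "covering_system (N \<union> E \<union> T)"
    unfolding covering_system_def using covA oddA by fastforce
  then have "odd_covering_system (N \<union> E \<union> T)"
    unfolding odd_covering_system_def using oddA injA by blast
  then show ?thesis ..
qed

end
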